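(* Assume there are $\vartheta\in[0,1]$ and $L_\vartheta \ge 0$ with $D_f(u,v) \le \frac{L_\vartheta}{1+\vartheta}\|u-v\|^{1+\vartheta}$ for all $u,v\in\mathbb{R}^d$. Let $\{x_k\}$ be generated from $x_0\in\mathcal{X}\setminus\mathcal{X}_\star$ by $$x_{k+1}\in\operatorname{argmin}_{z\in\mathcal{X}\cap\mathcal{B}(x_k,t_k)}\langle\nabla f(x_k),z\rangle ,\qquad t_k = t(x_k) = \frac{f(x_k)-f_\star}{\|\nabla f(x_k)\|},$$ the run stopping if some $x_k\in\mathcal{X}_\star$. Then, for all $K\ge1$, $$\min_{0\le k\le K}\bigl(f(x_k)-f_\star\bigr) \le \max\left\{\Lambda_1 K^{-\frac{1+\vartheta}{2}},\ \Lambda_2 K^{-\frac{1}{2-\vartheta}}\right\},$$ where $R=\operatorname{dist}(x_0,\mathcal{X}_\star)$, $G_\star=\|\nabla f(x_\star)\|$ for any $x_\star\in\mathcal{X}_\star$, and $$\Lambda_1 := \tfrac{25}{2}L_\vartheta R^{1+\vartheta},\qquad \Lambda_2 := 25\max\left\{\bigl(L_\vartheta R^2G_\star^{1-\vartheta}\bigr)^{\frac{1}{2-\vartheta}},\ G_\star R\right\}.$$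
   Context: Standing assumption: $\mathcal{X} \subseteq \mathbb{R}^d$ is non-empty, closed and convex; $f:\mathbb{R}^d\to\mathbb{R}$ is convex and differentiable; the solution set $\mathcal{X}_\star := \operatorname{argmin}_{z\in\mathcal{X}} f(z)$ is non-empty. Write $f_\star := \min_{z\in\mathcal{X}} f(z)$. Norms and inner products are Euclidean. For $x\in\mathcal{X}\setminus\mathcal{X}_\star$ one has $\nabla f(x)\neq 0$. $D_f(u,v) := f(u)-f(v)-\langle\nabla f(v),u-v\rangle$ is the Bregman divergence; $\mathcal{B}(x,t) := \{z\in\mathbb{R}^d:\|z-x\|\le t\}$; $\operatorname{dist}$ is the Euclidean distance. The gradient of $f$ is constant on $\mathcal{X}_\star$, so $G_\star$ does not depend on the choice of $x_\star$. Convention: if the run stops at some $x_j\in\mathcal{X}_\star$ with $j\le K$, the minimum is over the iterates generated and equals $0$. *)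

theory Defs
  imports "HOL-Analysis.Analysis"
begin

definition gradient :: "('a::euclidean_space \<Rightarrow> real) \<Rightarrow> 'a \<Rightarrow> 'a" where
  "gradient f x = (THE D. GDERIV f x :> D)"

lemma gradient_eqI:
  assumes "GDERIV f x :> D"
  shows "gradient f x = D"
  unfolding gradient_def
proof (rule the_equality)
  fix D' assume "GDERIV f x :> D'"
  then have "(\<lambda>h. h \<bullet> D') = (\<lambda>h. h \<bullet> D)"
    using assms unfolding gderiv_def by (rule has_derivative_unique)
  then have "(D' - D) \<bullet> (D' - D) = 0"
    by (simp add: fun_eq_iff inner_diff_right)
  then show "D' = D"
    by simp
qed (fact assms)

lemma differentiable_imp_GDERIV_gradient:
  assumes "f differentiable (at x)"
  shows "GDERIV f x :> gradient f x"
proof -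
  obtain f' where f': "(f has_derivative f') (at x)"
    using assms unfolding differentiable_def by blast
  have "f' = (\<lambda>h. h \<bullet> adjoint f' 1)"
    using adjoint_works[OF has_derivative_linear[OF f'], of _ 1] by (simp add: fun_eq_iff)
  with f' have D: "GDERIV f x :> adjoint f' 1"
    unfolding gderiv_def by (rule subst[rotated])
  show ?thesis
    using D by (simp only: gradient_eqI[OF D])
qed

definition bregman :: "('a::euclidean_space \<Rightarrow> real) \<Rightarrow> 'a \<Rightarrow> 'a \<Rightarrow> real" where
  "bregman f u v = f u - f v - gradient f v \<bullet> (u - v)"

definition argmin_set :: "('a \<Rightarrow> real) \<Rightarrow> 'a set \<Rightarrow> 'a set" where
  "argmin_set f S = {x. is_arg_min f (\<lambda>z. z \<in> S) x}"

text \<open>The minimum of \<open>f\<close> over \<open>S\<close>; only meaningful if it is attained.\<close>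

definition min_value :: "('a \<Rightarrow> real) \<Rightarrow> 'a set \<Rightarrow> real" where
  "min_value f S = (INF z\<in>S. f z)"

definition step_radius :: "('a::euclidean_space \<Rightarrow> real) \<Rightarrow> 'a set \<Rightarrow> 'a \<Rightarrow> real" where
  "step_radius f X x = (f x - min_value f X) / norm (gradient f x)"

text \<open>
  A run is a total sequence; the iterates actually generated are those with
  index in \<open>generated f X x\<close>, i.e. up to and including the first one in the
  solution set. Entries with a later index are unconstrained and must not be used.
\<close>

definition generated :: "('a \<Rightarrow> real) \<Rightarrow> 'a set \<Rightarrow> (nat \<Rightarrow> 'a) \<Rightarrow> nat set" where
  "generated f X x = {k. \<forall>j<k. x j \<notin> argmin_set f X}"

definition is_run :: "('a::euclidean_space \<Rightarrow> real) \<Rightarrow> 'a set \<Rightarrow> (nat \<Rightarrow> 'a) \<Rightarrow> bool" where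
  "is_run f X x \<longleftrightarrow>
     x 0 \<in> X - argmin_set f X \<and>
     (\<forall>k. Suc k \<in> generated f X x \<longrightarrow>
        x (Suc k) \<in> argmin_set (\<lambda>z. gradient f (x k) \<bullet> z) (X \<inter> cball (x k) (step_radius f X (x k))))"

text \<open>
  Real power of a nonnegative base with the convention \<open>0\<^sup>0 = 1\<close>; the library
  has \<open>0 powr 0 = 0\<close>, which would make \<open>G powr (1 - \<theta>)\<close> vanish for
  \<open>\<theta> = 1\<close> and \<open>G = 0\<close>.
\<close>

definition rpow :: "real \<Rightarrow> real \<Rightarrow> real" where
  "rpow x a = (if a = 0 then 1 else x powr a)"

definition Lambda1 :: "real \<Rightarrow> real \<Rightarrow> real \<Rightarrow> real" where
  "Lambda1 \<theta> L R = 25 / 2 * L * rpow R (1 + \<theta>)"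

definition Lambda2 :: "real \<Rightarrow> real \<Rightarrow> real \<Rightarrow> real \<Rightarrow> real" where
  "Lambda2 \<theta> L R G = 25 * max (rpow (L * R\<^sup>2 * rpow G (1 - \<theta>)) (1 / (2 - \<theta>))) (G * R)"

end

theory Submission
  imports Defs
begin

text \<open>
  Write \<open>\<delta>\<close>, \<open>t\<close> for the gap and radius at an iterate, \<open>A = L t\<^sup>1\<^sup>+\<^sup>\<theta> / (1 + \<theta>)\<close>, \<open>P\<close> for the decrease
  of the linear model in one step, and \<open>D\<close> for the decrease of the squared distance to a fixed
  solution. Optimality of the step gives \<open>t\<^sup>2 \<le> D\<close> and \<open>2 t\<^sup>2 (\<delta>' - A) \<le> P (D - t\<^sup>2)\<close>, while the
  upper model gives \<open>\<delta>' \<le> \<delta> - P + A\<close>; eliminating \<open>P\<close> yields \<open>\<delta> - \<delta>' \<ge> t\<^sup>2 \<delta> / D - A\<close>. The gradient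
  norm is within \<open>\<delta> / r + L r\<^sup>\<theta> / (1 + \<theta>)\<close> of \<open>G\<^sub>\<star>\<close> for every \<open>r > 0\<close>, so \<open>t\<close> is of order \<open>\<delta> / G\<^sub>\<star>\<close> once
  \<open>\<delta>\<close> is small. Since the \<open>D\<close> sum to at most \<open>R\<^sup>2\<close>, the potential \<open>\<delta>\<^sup>-\<^sup>\<theta> / \<theta>\<close>, truncated where this
  comparison fails, would exceed \<open>K / 25\<close> (in units with \<open>L = G\<^sub>\<star> = 1\<close>) if all gaps exceeded the
  claimed bound; but it is at most \<open>1 / \<delta> \<le> K / 25\<close>. If \<open>L R\<^sup>\<theta> < G\<^sub>\<star>\<close>, then \<open>L\<close> may be raised to
  \<open>G\<^sub>\<star> / R\<^sup>\<theta>\<close> at no cost: this is the term \<open>G\<^sub>\<star> R\<close> of \<open>\<Lambda>\<^sub>2\<close>.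
\<close>

subsection \<open>Sequences of gaps and steps\<close>

text \<open>Weighted AM-GM for \<open>a\<close> and 1. It supplies bounds such as
  \<open>4 powr \<theta> \<le> 1 + 3 * \<theta>\<close>.\<close>

lemma powr_le_affine:
  fixes a \<theta> :: real
  assumes "0 < a" "0 \<le> \<theta>" "\<theta> \<le> 1"
  shows "a powr \<theta> \<le> 1 + \<theta> * (a - 1)"
  using Youngs_inequality_0[of \<theta> "1 - \<theta>" a 1] assms by (simp add: algebra_simps)

lemma powr_neg_ge_affine:
  fixes v \<theta> :: real
  assumes "0 < v" "0 \<le> \<theta>"
  shows "1 + \<theta> * (1 - v) \<le> v powr (- \<theta>)"
proof -
  have "\<theta> * ln v \<le> \<theta> * (v - 1)"
    using assms by (intro mult_left_mono ln_le_minus_one) auto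
  moreover have "1 + - \<theta> * ln v \<le> exp (- \<theta> * ln v)"
    by (rule exp_ge_add_one_self)
  ultimately show ?thesis
    using assms by (simp add: powr_def algebra_simps)
qed

text \<open>The tangent at 1, moved to \<open>a\<close> by homogeneity. Divided by \<theta>, it
  turns a decrease of the gap into an increase of the potential.\<close>

lemma powr_neg_above_tangent:
  fixes a b \<theta> :: real
  assumes "0 < a" "0 < b" "0 \<le> \<theta>"
  shows "a powr (- \<theta>) + \<theta> * (a powr (- 1 - \<theta>) * (a - b)) \<le> b powr (- \<theta>)"
proof -
  have "a powr (- \<theta>) * (1 + \<theta> * (1 - b / a)) \<le> a powr (- \<theta>) * (b / a) powr (- \<theta>)"
    using assms by (intro mult_left_mono powr_neg_ge_affine) auto
  moreover have "a powr (- 1 - \<theta>) * (a - b) = a powr (- \<theta>) * (1 - b / a)"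
    using assms powr_diff[of a "- \<theta>" 1] by (simp add: minus_diff_commute field_simps)
  ultimately show ?thesis
    using assms by (simp only:) (simp add: powr_divide distrib_left mult_ac)
qed

text \<open>Evaluates the gradient bound at radius \<open>r = 4 t\<close>.\<close>

lemma gap_le_of_step:
  fixes \<theta> L G g t \<delta> :: real
  assumes "0 \<le> \<theta>" "\<theta> \<le> 1" "0 \<le> L" "0 < t" "\<delta> = t * g"
    and grad: "\<And>r. 0 < r \<Longrightarrow> \<bar>g - G\<bar> \<le> \<delta> / r + L * r powr \<theta> / (1 + \<theta>)"
  shows "\<delta> \<le> 4 / 3 * (t * G) + 8 / 3 * (L * t powr (1 + \<theta>))"
proof -
  have "4 powr \<theta> / (1 + \<theta>) \<le> 2"
    using powr_le_affine[of 4 \<theta>] assms by (simp add: divide_simps)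
  then have "L * t powr \<theta> * (4 powr \<theta> / (1 + \<theta>)) \<le> L * t powr \<theta> * 2"
    using assms by (intro mult_left_mono) auto
  moreover have "g \<le> G + \<delta> / (4 * t) + L * (4 * t) powr \<theta> / (1 + \<theta>)"
    using grad[of "4 * t"] assms by simp
  ultimately have "g \<le> G + \<delta> / (4 * t) + 2 * L * t powr \<theta>"
    by (simp add: powr_mult mult_ac)
  then have "t * g \<le> t * (G + \<delta> / (4 * t) + 2 * L * t powr \<theta>)"
    using assms by (intro mult_left_mono) auto
  \<comment> \<open>At radius \<open>4 * t\<close> the term \<open>\<delta> / r\<close> contributes
    \<open>\<delta> / 4\<close>; absorbing it on the left gives the factors 4/3 and 8/3.\<close>
  then have "\<delta> \<le> t * G + \<delta> / 4 + 2 * L * (t * t powr \<theta>)"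
    using assms by (simp add: algebra_simps)
  moreover have "t * t powr \<theta> = t powr (1 + \<theta>)"
    using assms by (simp add: powr_add)
  ultimately show ?thesis
    by simp
qed

text \<open>Pigeonhole on the squared steps, whose sum is at most \<open>R\<^sup>2\<close>.\<close>

lemma exists_step_le:
  fixes t D :: "nat \<Rightarrow> real" and R :: real
  assumes "K \<ge> 1" "0 \<le> R"
    and "\<And>k. k < K \<Longrightarrow> (t k)\<^sup>2 \<le> D k"
    and "(\<Sum>k<K. D k) \<le> R\<^sup>2"
  shows "\<exists>k<K. t k \<le> R / sqrt K"
proof (rule ccontr)
  assume "\<not> ?thesis"
  then have *: "R / sqrt K < t k" if "k < K" for k
    using that by (meson not_le)
  have "(R / sqrt K)\<^sup>2 < D k" if "k < K" for k
    using assms(3)[OF that] power_strict_mono[OF *[OF that], of 2] assms(2) by simp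
  then have "(\<Sum>k<K. (R / sqrt K)\<^sup>2) < (\<Sum>k<K. D k)"
    using assms(1) by (intro sum_strict_mono) (auto simp: lessThan_empty_iff)
  then show False
    using assms by (simp add: power_divide)
qed

section \<open>The rate in units with \<open>L = G = 1\<close>\<close>

lemma normalised_gap_bound:
  fixes \<theta> R :: real and \<delta> t g P D :: "nat \<Rightarrow> real"
  assumes \<theta>: "0 < \<theta>" "\<theta> \<le> 1" and K: "K \<ge> 1" and R: "R \<ge> 1"
    and \<delta>_pos: "\<And>k. k \<le> K \<Longrightarrow> 0 < \<delta> k"
    and t_pos: "\<And>k. k < K \<Longrightarrow> 0 < t k"
    and \<delta>_eq: "\<And>k. k < K \<Longrightarrow> \<delta> k = t k * g k"
    and grad: "\<And>k r. k < K \<Longrightarrow> 0 < r \<Longrightarrow> \<bar>g k - 1\<bar> \<le> \<delta> k / r + r powr \<theta> / (1 + \<theta>)"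
    and descent: "\<And>k. k < K \<Longrightarrow> \<delta> (Suc k) \<le> \<delta> k - P k + t k powr (1 + \<theta>) / (1 + \<theta>)"
    and prox: "\<And>k. k < K \<Longrightarrow>
      2 * (t k)\<^sup>2 * (\<delta> (Suc k) - t k powr (1 + \<theta>) / (1 + \<theta>)) \<le> P k * (D k - (t k)\<^sup>2)"
    and fejer: "\<And>k. k < K \<Longrightarrow> (t k)\<^sup>2 \<le> D k"
    and total: "(\<Sum>k<K. D k) \<le> R\<^sup>2"
  shows "\<exists>k\<le>K. \<delta> k \<le> max (25 / 2 * (R / sqrt K) powr (1 + \<theta>)) (25 * (R / sqrt K) powr (2 / (2 - \<theta>)))"
proof (rule ccontr)
  define y where "y = R / sqrt K"
  \<comment> \<open>Chosen so that the second term of the claimed bound factors as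
    \<open>25 * (y * z)\<close>.\<close>
  define z where "z = y powr (\<theta> / (2 - \<theta>))"
  have y: "0 < y"
    using R K by (simp add: y_def)
  have z: "0 < z"
    using y by (simp add: z_def)
  have y2: "y\<^sup>2 = R\<^sup>2 / K"
    using K by (simp add: y_def power_divide)
  have yz: "y powr (2 / (2 - \<theta>)) = y * z"
  proof -
    have "2 / (2 - \<theta>) = 1 + \<theta> / (2 - \<theta>)"
      using \<theta> by (simp add: field_simps)
    then show ?thesis
      unfolding z_def using y by (simp only: powr_add) simp
  qed
  assume "\<not> ?thesis"
  then have big: "max (25 / 2 * y powr (1 + \<theta>)) (25 * (y * z)) < \<delta> k" if "k \<le> K" for k
    using that unfolding y_def[symmetric] yz by (meson not_le)
  \<comment> \<open>One short step bounds a gap in terms of \<open>y\<close> alone. As that gap also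
    exceeds both terms of the claimed bound, \<open>y < 1\<close> and \<open>z < 6 / 100\<close>
    follow.\<close>
  obtain k0 where k0: "k0 < K" "t k0 \<le> y"
    using exists_step_le[OF K _ fejer total] R unfolding y_def by auto
  have "\<delta> k0 \<le> 4 / 3 * t k0 + 8 / 3 * t k0 powr (1 + \<theta>)"
    using gap_le_of_step[of \<theta> 1 "t k0" "\<delta> k0" "g k0" 1] \<theta> t_pos \<delta>_eq grad k0(1) by simp
  also have "\<dots> \<le> 4 / 3 * y + 8 / 3 * y powr (1 + \<theta>)"
    using k0 t_pos[OF k0(1)] \<theta> by (intro add_mono mult_left_mono powr_mono2) auto
  finally have k0_le: "\<delta> k0 \<le> 4 / 3 * y + 8 / 3 * y powr (1 + \<theta>)" .
  have y1: "y < 1"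
  proof (rule ccontr)
    assume "\<not> y < 1"
    then have "y \<le> y powr (1 + \<theta>)"
      using powr_mono[of 1 "1 + \<theta>" y] \<theta> by simp
    moreover have "25 / 2 * y powr (1 + \<theta>) < \<delta> k0"
      using big[of k0] k0 by simp
    ultimately show False
      using k0_le y by linarith
  qed
  have yz_ge: "y powr (1 + \<theta>) \<le> y * z"
  proof -
    \<comment> \<open>The exponents compare through \<open>(1 + \<theta>) * (2 - \<theta>) = 2 +
      \<theta> * (1 - \<theta>)\<close>.\<close>
    have "0 \<le> \<theta> * (1 - \<theta>)"
      using \<theta> by simp
    then have "\<theta> / (2 - \<theta>) \<le> \<theta>"
      using \<theta> by (simp add: field_simps)
    then have "2 / (2 - \<theta>) \<le> 1 + \<theta>"
      using \<theta> by (simp add: field_simps)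
    then show ?thesis
      using powr_mono'[of "2 / (2 - \<theta>)" "1 + \<theta>" y] y y1 yz by simp
  qed
  have z_small: "z < 6 / 100"
  proof -
    have "25 * (y * z) < 4 / 3 * y + 8 / 3 * (y * z)"
      using big[of k0] k0 k0_le yz_ge by simp
    then have "y * (25 * z) < y * (4 / 3 + 8 / 3 * z)"
      by (simp add: algebra_simps)
    then show ?thesis
      using y by simp
  qed
  have y\<theta>: "y powr \<theta> < 6 / 100"
  proof -
    have "y powr \<theta> = z powr (2 - \<theta>)"
      using \<theta> by (simp add: z_def powr_powr)
    also have "\<dots> \<le> z powr 1"
      using \<theta> z z_small by (intro powr_mono') auto
    finally show ?thesis
      using z z_small by simp
  qed

  text \<open>
    For gaps below \<open>T\<close>, the gradient bound at \<open>r = 4 \<delta>\<close> puts \<open>g\<close> between \<open>1 / 2\<close> and \<open>3 / 2\<close>;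
    \<open>8 = T powr (- \<theta>)\<close> truncates the potential there.
  \<close>
  define T where "T = (1 / 8) powr (1 / \<theta>)"
  have T: "0 < T" "T powr \<theta> = 1 / 8" "T powr (- \<theta>) = 8"
    using \<theta> by (simp_all add: T_def powr_powr powr_minus)
  have T_large: "17 / 10 * y \<le> T"
  proof -
    have "(17 / 10 * y) powr \<theta> = (17 / 10) powr \<theta> * y powr \<theta>"
      by (rule powr_mult)
    also have "\<dots> \<le> 17 / 10 * (6 / 100)"
      using powr_mono[of \<theta> 1 "17 / 10"] \<theta> y\<theta> by (intro mult_mono) auto
    also have "\<dots> < T powr \<theta>"
      by (simp add: T)
    finally show ?thesis
      using powr_less_cancel2[of \<theta> "17 / 10 * y" T] powr_mono2[of \<theta> T "17 / 10 * y"] T \<theta> y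
      by (meson less_eq_real_def linorder_not_le)
  qed

  \<comment> \<open>Dividing by \<theta> makes the slope \<open>- s powr (- 1 - \<theta>)\<close>
    wherever the truncation is inactive.\<close>
  define \<phi> where "\<phi> s = max 0 ((s powr (- \<theta>) - 8) / \<theta>)" for s :: real
  have r4: "(4 * s) powr \<theta> / (1 + \<theta>) \<le> 1 / 4" if "0 < s" "s \<le> T" for s
  proof -
    have "(4 * s) powr \<theta> \<le> (4 * T) powr \<theta>"
      using that \<theta> by (intro powr_mono2) auto
    also have "\<dots> = 4 powr \<theta> / 8"
      using T by (simp add: powr_mult)
    also have "\<dots> \<le> (1 + \<theta>) / 4"
      using powr_le_affine[of 4 \<theta>] \<theta> by simp
    finally show ?thesis
      using \<theta> by (simp add: field_simps)
  qed
  \<comment> \<open>Affine in \<open>D k\<close>, so that only the sum of the \<open>D k\<close>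
    matters: \<open>3 - 9 / 4 * q\<close> is the tangent of \<open>1 / q\<close> at 2/3. Since
    \<open>q = D k / y\<^sup>2\<close> averages at most 1, the mean gain is at least
    \<open>100 / 9 * (3 / 4) - 2 = 19 / 3\<close>. Touching at 2/3 rather than 1 makes the bound
    nonpositive for the long steps taken at large gaps.\<close>
  have gain: "100 / 9 * (3 - 9 / 4 * (D k / y\<^sup>2)) - 2 \<le> \<phi> (\<delta> (Suc k)) - \<phi> (\<delta> k)" if k: "k < K" for k
  proof (cases "\<delta> k < T")
    case True
    define A where "A = t k powr (1 + \<theta>) / (1 + \<theta>)"
    define s where "s = t k / \<delta> k"
    have pos: "0 < \<delta> k" "0 < t k" "0 < \<delta> (Suc k)"
      using \<delta>_pos t_pos k by simp_all
    have D: "0 < D k" "(t k)\<^sup>2 \<le> D k"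
      using fejer[OF k] pos(2) by (auto intro: less_le_trans[of _ "(t k)\<^sup>2"])
    have "\<bar>g k - 1\<bar> \<le> 1 / 2"
      using grad[OF k, of "4 * \<delta> k"] r4[of "\<delta> k"] True pos
      by (simp del: divide_le_eq_numeral1 le_divide_eq_numeral1)
    then have g: "1 / 2 \<le> g k" "g k \<le> 3 / 2"
      by linarith+
    have "s * g k = 1"
      using \<delta>_eq[OF k] pos(1) by (auto simp: s_def)
    moreover have "0 < s"
      using pos by (simp add: s_def)
    ultimately have s: "2 / 3 \<le> s" "s \<le> 2"
      using mult_left_mono[OF g(1), of s] mult_left_mono[OF g(2), of s] by simp_all
    text \<open>Eliminating \<open>P k\<close> between descent and prox bounds the decrease from below.\<close>
    have dec: "(t k)\<^sup>2 * \<delta> k / D k - A \<le> \<delta> k - \<delta> (Suc k)"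
    proof -
      define E where "E = \<delta> k - \<delta> (Suc k) + A"
      have "2 * (t k)\<^sup>2 * (\<delta> k - E) \<le> P k * (D k - (t k)\<^sup>2)"
        using prox[OF k] by (simp add: E_def A_def)
      also have "\<dots> \<le> E * (D k - (t k)\<^sup>2)"
        using descent[OF k] D by (intro mult_right_mono) (auto simp: E_def A_def)
      finally have *: "2 * (t k)\<^sup>2 * \<delta> k \<le> E * (D k + (t k)\<^sup>2)"
        by (simp add: algebra_simps)
      have "0 < 2 * (t k)\<^sup>2 * \<delta> k"
        using pos by simp
      with * have "0 < E * (D k + (t k)\<^sup>2)"
        by linarith
      then have "0 < E"
        using D by (simp add: zero_less_mult_iff add_pos_nonneg)
          (metis add_nonneg_nonneg less_eq_real_def linorder_not_less zero_le_power2)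
      then have "E * (t k)\<^sup>2 \<le> E * D k"
        using D by (intro mult_left_mono) auto
      then have "(t k)\<^sup>2 * \<delta> k \<le> E * D k"
        using * by (simp add: algebra_simps)
      then show ?thesis
        using D by (simp add: E_def field_simps)
    qed
    \<comment> \<open>Minus the slope of the untruncated potential at
      \<open>\<delta> k\<close>.\<close>
    define w where "w = \<delta> k powr (- 1 - \<theta>)"
    have w: "0 < w"
      using pos by (simp add: w_def)
    have wA: "w * A \<le> 2"
    proof -
      have "w * A = s powr (1 + \<theta>) / (1 + \<theta>)"
        using powr_minus_divide[of "\<delta> k" "1 + \<theta>"]
        by (simp add: w_def A_def s_def powr_divide)
      also have "\<dots> \<le> 2 powr (1 + \<theta>) / (1 + \<theta>)"
        using s \<theta> by (intro divide_right_mono powr_mono2) auto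
      also have "\<dots> \<le> 2"
        using powr_le_affine[of 2 \<theta>] \<theta> by (simp add: powr_add divide_simps)
      finally show ?thesis .
    qed
    \<comment> \<open>The negated claim gives
      \<open>25 * y\<^sup>2 \<le> \<delta> k powr (2 - \<theta>)\<close>; together with
      \<open>s \<ge> 2 / 3\<close> this explains \<open>100 / 9 = 4 / 9 * 25\<close>.\<close>
    have wE: "100 / 9 * (y\<^sup>2 / D k) \<le> w * ((t k)\<^sup>2 * \<delta> k / D k)"
    proof -
      have "2 / (2 - \<theta>) * (2 - \<theta>) = 2"
        using \<theta> by (simp add: divide_eq_eq)
      then have "25 * y\<^sup>2 = 25 * (y * z) powr (2 - \<theta>)"
        using y by (simp only: yz[symmetric] powr_powr powr_numeral)
      also have "\<dots> \<le> 25 powr (2 - \<theta>) * (y * z) powr (2 - \<theta>)"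
        using \<theta> powr_mono[of 1 "2 - \<theta>" 25] by (intro mult_right_mono) auto
      also have "\<dots> = (25 * (y * z)) powr (2 - \<theta>)"
        by (simp add: powr_mult)
      also have "\<dots> \<le> \<delta> k powr (2 - \<theta>)"
        using big[of k] k \<theta> y z by (intro powr_mono2) auto
      finally have "4 / 9 * (25 * y\<^sup>2) \<le> s\<^sup>2 * \<delta> k powr (2 - \<theta>)"
        using s power_mono[of "2 / 3" s 2] by (intro mult_mono) (auto simp: power2_eq_square)
      also have "\<delta> k powr (2 - \<theta>) = w * \<delta> k ^ 3"
        using pos powr_add[of "\<delta> k" "- 1 - \<theta>" 3] by (simp add: w_def powr_numeral)
      also have "s\<^sup>2 * (w * \<delta> k ^ 3) = w * ((t k)\<^sup>2 * \<delta> k)"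
        using pos by (simp add: s_def field_simps power2_eq_square power3_eq_cube)
      finally show ?thesis
        using D by (simp add: field_simps)
    qed
    have "3 - 9 / 4 * q \<le> 1 / q" if "0 < q" for q :: real
    proof -
      have "0 \<le> (3 / 2 * q - 1)\<^sup>2"
        by simp
      then show ?thesis
        using that by (simp add: field_simps power2_eq_square)
    qed
    from this[of "D k / y\<^sup>2"] have "3 - 9 / 4 * (D k / y\<^sup>2) \<le> y\<^sup>2 / D k"
      using D y by simp
    then have "100 / 9 * (3 - 9 / 4 * (D k / y\<^sup>2)) - 2 \<le> w * ((t k)\<^sup>2 * \<delta> k / D k) - w * A"
      using diff_mono[OF order_trans[OF mult_left_mono wE] wA, of "3 - 9 / 4 * (D k / y\<^sup>2)"] by simp
    also have "\<dots> \<le> w * (\<delta> k - \<delta> (Suc k))"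
      using mult_left_mono[OF dec, of w] w by (simp add: right_diff_distrib)
    also have "\<dots> \<le> (\<delta> (Suc k) powr (- \<theta>) - \<delta> k powr (- \<theta>)) / \<theta>"
      using powr_neg_above_tangent[of "\<delta> k" "\<delta> (Suc k)" \<theta>] pos \<theta>
      by (simp add: w_def field_simps)
    also have "\<dots> = (\<delta> (Suc k) powr (- \<theta>) - 8) / \<theta> - (\<delta> k powr (- \<theta>) - 8) / \<theta>"
      by (simp add: diff_divide_distrib)
    \<comment> \<open>Truncation is inactive at \<open>\<delta> k\<close> and can only raise the
      value at \<open>\<delta> (Suc k)\<close>.\<close>
    also have "\<dots> \<le> \<phi> (\<delta> (Suc k)) - \<phi> (\<delta> k)"
    proof -
      have "8 \<le> \<delta> k powr (- \<theta>)"
        using powr_mono2'[of "- \<theta>" "\<delta> k" T] True pos \<theta> T by simp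
      then have "\<phi> (\<delta> k) = (\<delta> k powr (- \<theta>) - 8) / \<theta>"
        using \<theta> by (simp add: \<phi>_def)
      then show ?thesis
        by (simp add: \<phi>_def)
    qed
    finally show ?thesis .
  next
    case False
    have pos: "0 < \<delta> k" "0 < t k"
      using \<delta>_pos t_pos k by simp_all
    have "\<delta> k powr (- \<theta>) \<le> T powr (- \<theta>)"
      using False T \<theta> by (intro powr_mono2') auto
    then have "\<phi> (\<delta> k) = 0"
      using T \<theta> by (simp add: \<phi>_def divide_nonpos_pos)
    moreover have "0 \<le> \<phi> (\<delta> (Suc k))"
      by (simp add: \<phi>_def)
    \<comment> \<open>Otherwise the gradient bound at \<open>r = 4 * T\<close> gives
      \<open>\<delta> k \<le> 5 / 4 * t k + \<delta> k / 6\<close>, hence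
      \<open>\<delta> k \<le> 3 / 2 * t k < T\<close>.\<close>
    moreover have "2 / 3 * T \<le> t k"
    proof (rule ccontr)
      assume small: "\<not> 2 / 3 * T \<le> t k"
      have "g k \<le> 5 / 4 + \<delta> k / (4 * T)"
        using grad[OF k, of "4 * T"] r4[of T] T(1)
        by (simp del: divide_le_eq_numeral1 le_divide_eq_numeral1)
      then have "t k * g k \<le> t k * (5 / 4 + \<delta> k / (4 * T))"
        using pos by (intro mult_left_mono) auto
      then have "\<delta> k \<le> 5 / 4 * t k + t k / T * (\<delta> k / 4)"
        using \<delta>_eq[OF k] by (simp add: algebra_simps)
      also have "t k / T * (\<delta> k / 4) \<le> 2 / 3 * (\<delta> k / 4)"
        using small pos T by (intro mult_right_mono) (auto simp: field_simps)
      finally show False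
        using small False by simp
    qed
    then have "2 / 3 * (17 / 10 * y) \<le> t k"
      using T_large by linarith
    then have "(2 / 3 * (17 / 10 * y))\<^sup>2 \<le> (t k)\<^sup>2"
      using y by (intro power_mono) auto
    then have "289 / 225 * y\<^sup>2 \<le> D k"
      using fejer[OF k] by (simp add: power_mult_distrib power_divide)
    then have "289 / 225 \<le> D k / y\<^sup>2"
      using y by (simp add: field_simps)
    moreover have "100 / 9 * (3 - 9 / 4 * q) - 2 \<le> 0" if "289 / 225 \<le> q" for q :: real
      using that by simp
    ultimately show ?thesis
      by (smt (verit))
  qed
  have "K * (19 / 3) \<le> (\<Sum>k<K. 100 / 9 * (3 - 9 / 4 * (D k / y\<^sup>2)) - 2)"
  proof -
    have "(\<Sum>k<K. 100 / 9 * (3 - 9 / 4 * (D k / y\<^sup>2)) - 2) = (\<Sum>k<K. 94 / 3 - 25 / y\<^sup>2 * D k)"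
      by (intro sum.cong) (auto simp: algebra_simps)
    also have "\<dots> = K * (94 / 3) - 25 / y\<^sup>2 * (\<Sum>k<K. D k)"
      by (simp add: sum_subtractf sum_distrib_left)
    also have "\<dots> \<ge> K * (94 / 3) - 25 / y\<^sup>2 * R\<^sup>2"
      using total by (intro diff_left_mono mult_left_mono) auto
    also have "25 / y\<^sup>2 * R\<^sup>2 = K * 25"
      using R K by (simp add: y2)
    finally show ?thesis
      by simp
  qed
  also have "\<dots> \<le> (\<Sum>k<K. \<phi> (\<delta> (Suc k)) - \<phi> (\<delta> k))"
    using gain by (intro sum_mono) auto
  also have "\<dots> = \<phi> (\<delta> K) - \<phi> (\<delta> 0)"
    by (rule sum_lessThan_telescope)
  also have "\<dots> \<le> \<phi> (\<delta> K)"
    by (simp add: \<phi>_def)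
  also have "\<dots> \<le> 1 / \<delta> K"
  proof -
    have "(1 / \<delta> K) powr \<theta> \<le> 1 + \<theta> * (1 / \<delta> K - 1)"
      using \<delta>_pos \<theta> by (intro powr_le_affine) auto
    then have "\<delta> K powr (- \<theta>) \<le> 8 + \<theta> * (1 / \<delta> K)"
      using \<theta> by (simp add: powr_minus_divide powr_divide algebra_simps)
    then show ?thesis
      using \<theta> \<delta>_pos[of K] by (simp add: \<phi>_def field_simps)
  qed
  \<comment> \<open>Here \<open>R \<ge> 1\<close> enters, through
    \<open>25 / K \<le> 25 * y\<^sup>2 < \<delta> K\<close>.\<close>
  also have "\<dots> < K / 25"
  proof -
    have "y * y \<le> y * z"
    proof -
      have "y powr 1 \<le> z"
        unfolding z_def using \<theta> y y1 by (intro powr_mono') auto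
      then show ?thesis
        using y by simp
    qed
    then have "25 * y\<^sup>2 < \<delta> K"
      using big[of K] by (simp add: power2_eq_square)
    moreover have "1 / K \<le> y\<^sup>2"
      using R K by (simp add: y2 divide_right_mono)
    ultimately have "25 * (1 / K) < \<delta> K"
      by linarith
    then show ?thesis
      using K \<delta>_pos[of K] by (simp add: field_simps)
  qed
  finally show False
    using K by simp
qed

section \<open>Rescaling to general constants\<close>

lemma powr_divide_sqrt:
  fixes R a :: real and K :: nat
  shows "(R / sqrt K) powr a = R powr a * K powr (- (a / 2))"
proof -
  have "sqrt K powr a = K powr (a / 2)"
    by (simp add: powr_half_sqrt[symmetric] powr_powr)
  then show ?thesis
    by (simp add: powr_divide powr_minus_divide)
qed

text \<open>
  The run enters only through the gaps \<open>\<delta> k = f (x k) - f\<^sub>\<star>\<close>, the radii \<open>t k\<close>, the gradient norms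
  \<open>g k\<close>, the linear decreases \<open>P k = \<nabla>f (x k) \<bullet> (x k - x (k + 1))\<close>, and the decreases \<open>D k\<close> of the
  squared distance to the solution nearest to \<open>x 0\<close>.
\<close>

locale gap_sequence =
  fixes \<theta> L G R :: real and K :: nat and \<delta> t g P D :: "nat \<Rightarrow> real"
  assumes \<theta>: "0 \<le> \<theta>" "\<theta> \<le> 1" and L: "0 \<le> L" and G: "0 \<le> G" and R: "0 < R" and K: "K \<ge> 1"
    and \<delta>_pos: "\<And>k. k \<le> K \<Longrightarrow> 0 < \<delta> k"
    and t_pos: "\<And>k. k < K \<Longrightarrow> 0 < t k"
    and \<delta>_eq: "\<And>k. k < K \<Longrightarrow> \<delta> k = t k * g k"
    and grad: "\<And>k r. k < K \<Longrightarrow> 0 < r \<Longrightarrow> \<bar>g k - G\<bar> \<le> \<delta> k / r + L * r powr \<theta> / (1 + \<theta>)"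
    and descent: "\<And>k. k < K \<Longrightarrow> \<delta> (Suc k) \<le> \<delta> k - P k + L * t k powr (1 + \<theta>) / (1 + \<theta>)"
    and prox: "\<And>k. k < K \<Longrightarrow>
      2 * (t k)\<^sup>2 * (\<delta> (Suc k) - L * t k powr (1 + \<theta>) / (1 + \<theta>)) \<le> P k * (D k - (t k)\<^sup>2)"
    and fejer: "\<And>k. k < K \<Longrightarrow> (t k)\<^sup>2 \<le> D k"
    and total: "(\<Sum>k<K. D k) \<le> R\<^sup>2"
begin

text \<open>\<open>L\<close> occurs only as a factor of nonnegative error terms, so enlarging it
  weakens every hypothesis. This lets \<open>G \<le> L * R powr \<theta>\<close> be
  enforced.\<close>

lemma raise_constant:
  assumes "L \<le> L'"
  shows "gap_sequence \<theta> L' G R K \<delta> t g P D"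
proof -
  have le: "L * s powr a / (1 + \<theta>) \<le> L' * s powr a / (1 + \<theta>)" for s a
    using assms \<theta> by (intro divide_right_mono mult_right_mono) auto
  show ?thesis
  proof
    fix k assume k: "k < K"
    show "\<bar>g k - G\<bar> \<le> \<delta> k / r + L' * r powr \<theta> / (1 + \<theta>)" if "0 < r" for r
      using grad[OF k that] le[of r \<theta>] by linarith
    show "\<delta> (Suc k) \<le> \<delta> k - P k + L' * t k powr (1 + \<theta>) / (1 + \<theta>)"
      using descent[OF k] le[of "t k" "1 + \<theta>"] by linarith
    have "2 * (t k)\<^sup>2 * (\<delta> (Suc k) - L' * t k powr (1 + \<theta>) / (1 + \<theta>))
        \<le> 2 * (t k)\<^sup>2 * (\<delta> (Suc k) - L * t k powr (1 + \<theta>) / (1 + \<theta>))"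
      using le[of "t k" "1 + \<theta>"] by (intro mult_left_mono) auto
    also note prox[OF k]
    finally show "2 * (t k)\<^sup>2 * (\<delta> (Suc k) - L' * t k powr (1 + \<theta>) / (1 + \<theta>)) \<le> P k * (D k - (t k)\<^sup>2)" .
  qed (use \<theta> L G R K \<delta>_pos t_pos \<delta>_eq fejer total assms in auto)
qed

text \<open>Needs only one short step; it covers \<open>\<theta> = 0\<close> and
  \<open>G = 0\<close>, where the rescaling below breaks down.\<close>

lemma simple_bound:
  "\<exists>k\<le>K. \<delta> k \<le> 4 / 3 * (G * R * K powr (- (1 / 2)))
    + 8 / 3 * (L * R powr (1 + \<theta>) * K powr (- ((1 + \<theta>) / 2)))"
proof -
  obtain k where k: "k < K" "t k \<le> R / sqrt K"
    using exists_step_le[OF K _ fejer total] R by auto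
  have "\<delta> k \<le> 4 / 3 * (t k * G) + 8 / 3 * (L * t k powr (1 + \<theta>))"
    using gap_le_of_step[OF \<theta> L t_pos[OF k(1)] \<delta>_eq[OF k(1)] grad[OF k(1)]] .
  also have "\<dots> \<le> 4 / 3 * (R / sqrt K * G) + 8 / 3 * (L * (R / sqrt K) powr (1 + \<theta>))"
    using k t_pos[OF k(1)] \<theta> L G
    by (intro add_mono mult_left_mono mult_right_mono powr_mono2) auto
  also have "R / sqrt K * G = G * R * K powr (- (1 / 2))"
    using powr_divide_sqrt[of R K 1] R K by simp
  finally show ?thesis
    using k(1) unfolding powr_divide_sqrt by (intro exI[of _ k]) (simp add: mult.assoc)
qed

text \<open>
  In units where \<open>L = G = 1\<close>, that is with lengths divided by \<open>(G / L) powr (1 / \<theta>)\<close>,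
  the hypothesis \<open>G \<le> L * R powr \<theta>\<close> becomes \<open>R \<ge> 1\<close>.
\<close>

lemma scaled_bound:
  assumes "0 < \<theta>" "0 < G" "0 < L" and GR: "G \<le> L * R powr \<theta>"
  shows "\<exists>k\<le>K. \<delta> k \<le> max (25 / 2 * L * R powr (1 + \<theta>) * K powr (- ((1 + \<theta>) / 2)))
    (25 * (L * R\<^sup>2 * G powr (1 - \<theta>)) powr (1 / (2 - \<theta>)) * K powr (- (1 / (2 - \<theta>))))"
proof -
  define l where "l = (G / L) powr (1 / \<theta>)"
  have l: "0 < l" "l powr \<theta> = G / L"
    using assms by (simp_all add: l_def powr_powr)
  have p1: "(s / l) powr (1 + \<theta>) = L * s powr (1 + \<theta>) / (G * l)" if "0 < s" for s
    using l assms that by (simp add: powr_divide powr_add mult_ac)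
  have p0: "(r * l) powr \<theta> = r powr \<theta> * (G / L)" for r
    by (simp add: powr_mult l)
  have Gl: "0 < G * l"
    using assms l by simp
  \<comment> \<open>Lengths scale by \<open>l\<close> and gradients by \<open>G\<close>, hence gaps
    and linear decreases by \<open>G * l\<close>.\<close>
  have "\<exists>k\<le>K. \<delta> k / (G * l) \<le> max (25 / 2 * (R / l / sqrt K) powr (1 + \<theta>))
      (25 * (R / l / sqrt K) powr (2 / (2 - \<theta>)))"
  proof (rule normalised_gap_bound[where t = "\<lambda>k. t k / l" and g = "\<lambda>k. g k / G"
        and P = "\<lambda>k. P k / (G * l)" and D = "\<lambda>k. D k / l\<^sup>2"])
    show "0 < \<theta>" "\<theta> \<le> 1" "K \<ge> 1"
      using assms \<theta> K by auto
    show "1 \<le> R / l"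
    proof -
      have "l powr \<theta> \<le> R powr \<theta>"
        using GR assms by (simp add: l field_simps)
      then have "l \<le> R"
        using powr_less_mono2[of \<theta> R l] assms R by (meson less_eq_real_def not_le)
      then show ?thesis
        using l by simp
    qed
    show "0 < \<delta> k / (G * l)" if "k \<le> K" for k
      using \<delta>_pos[OF that] Gl by simp
    have "(\<Sum>k<K. D k / l\<^sup>2) = (\<Sum>k<K. D k) / l\<^sup>2"
      by (simp add: sum_divide_distrib)
    then show "(\<Sum>k<K. D k / l\<^sup>2) \<le> (R / l)\<^sup>2"
      using total by (simp add: power_divide divide_right_mono)
    fix k assume k: "k < K"
    show "0 < t k / l"
      using t_pos[OF k] l by simp
    show "\<delta> k / (G * l) = t k / l * (g k / G)"
      using \<delta>_eq[OF k] by simp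
    show "\<bar>g k / G - 1\<bar> \<le> \<delta> k / (G * l) / r + r powr \<theta> / (1 + \<theta>)" if "0 < r" for r
    proof -
      have "\<bar>g k / G - 1\<bar> = \<bar>g k - G\<bar> / G"
        using assms by (simp add: abs_div_pos diff_divide_distrib)
      also have "\<dots> \<le> (\<delta> k / (r * l) + L * (r * l) powr \<theta> / (1 + \<theta>)) / G"
        using grad[OF k, of "r * l"] that l assms by (intro divide_right_mono) auto
      also have "\<dots> = \<delta> k / (G * l) / r + r powr \<theta> / (1 + \<theta>)"
        unfolding p0 using assms by (simp add: add_divide_distrib mult_ac)
      finally show ?thesis .
    qed
    note p = p1[OF t_pos[OF k]]
    show "\<delta> (Suc k) / (G * l) \<le> \<delta> k / (G * l) - P k / (G * l) + (t k / l) powr (1 + \<theta>) / (1 + \<theta>)"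
      using divide_right_mono[OF descent[OF k], of "G * l"] Gl
      by (simp add: p add_divide_distrib diff_divide_distrib mult_ac)
    have "2 * (t k / l)\<^sup>2 * (\<delta> (Suc k) / (G * l) - (t k / l) powr (1 + \<theta>) / (1 + \<theta>))
        = 2 * (t k)\<^sup>2 * (\<delta> (Suc k) - L * t k powr (1 + \<theta>) / (1 + \<theta>)) / (l\<^sup>2 * (G * l))"
      by (simp add: p power_divide diff_divide_distrib right_diff_distrib mult_ac)
    also have "\<dots> \<le> P k * (D k - (t k)\<^sup>2) / (l\<^sup>2 * (G * l))"
      using prox[OF k] Gl by (intro divide_right_mono) auto
    also have "\<dots> = P k / (G * l) * (D k / l\<^sup>2 - (t k / l)\<^sup>2)"
      by (simp add: power_divide diff_divide_distrib right_diff_distrib mult_ac)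
    finally show "2 * (t k / l)\<^sup>2 * (\<delta> (Suc k) / (G * l) - (t k / l) powr (1 + \<theta>) / (1 + \<theta>))
        \<le> P k / (G * l) * (D k / l\<^sup>2 - (t k / l)\<^sup>2)" .
    show "(t k / l)\<^sup>2 \<le> D k / l\<^sup>2"
      using fejer[OF k] by (simp add: power_divide divide_right_mono)
  qed
  then obtain k where k: "k \<le> K" and le: "\<delta> k / (G * l) \<le> max (25 / 2 * (R / sqrt K / l) powr (1 + \<theta>))
      (25 * (R / sqrt K / l) powr (2 / (2 - \<theta>)))"
    by (auto simp: mult.commute)
  define y where "y = R / sqrt K"
  have y: "0 < y"
    using R K by (simp add: y_def)
  have e1: "G * l * (25 / 2 * (y / l) powr (1 + \<theta>)) = 25 / 2 * L * y powr (1 + \<theta>)"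
    using p1[OF y] assms l by simp
  \<comment> \<open>After raising to the power \<open>2 - \<theta>\<close>, the unit
    \<open>l\<close> survives only as \<open>l powr (- \<theta>) = L / G\<close>.\<close>
  have e2: "G * l * (25 * (y / l) powr (2 / (2 - \<theta>)))
      = 25 * ((L * R\<^sup>2 * G powr (1 - \<theta>)) powr (1 / (2 - \<theta>)) * K powr (- (1 / (2 - \<theta>))))"
  proof -
    have "((G * l) powr (2 - \<theta>)) powr (1 / (2 - \<theta>)) = G * l"
      using \<theta> Gl by (simp add: powr_powr)
    moreover have "((y / l) powr 2) powr (1 / (2 - \<theta>)) = (y / l) powr (2 / (2 - \<theta>))"
      by (simp only: powr_powr times_divide_eq_right mult_1_right)
    ultimately have "G * l * (y / l) powr (2 / (2 - \<theta>)) = ((G * l) powr (2 - \<theta>) * ((y / l) powr 2)) powr (1 / (2 - \<theta>))"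
      by (simp only: powr_mult)
    also have "(G * l) powr (2 - \<theta>) * ((y / l) powr 2) = L * R\<^sup>2 * G powr (1 - \<theta>) * (1 / K)"
    proof -
      have "G powr (2 - \<theta>) = G * G powr (1 - \<theta>)"
        using assms powr_add[of G 1 "1 - \<theta>"] by simp
      moreover have "l powr (2 - \<theta>) = l\<^sup>2 / (G / L)"
        using l by (simp add: powr_diff powr_numeral)
      moreover have "y\<^sup>2 = R\<^sup>2 / K"
        by (simp add: y_def power_divide)
      ultimately show ?thesis
        using l y assms by (simp add: powr_mult powr_numeral power_divide)
    qed
    also have "\<dots> powr (1 / (2 - \<theta>)) = (L * R\<^sup>2 * G powr (1 - \<theta>)) powr (1 / (2 - \<theta>)) * K powr (- (1 / (2 - \<theta>)))"
      unfolding powr_mult[of _ "1 / K"] by (simp add: powr_divide powr_minus_divide)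
    finally show ?thesis
      by simp
  qed
  have "\<delta> k \<le> G * l * max (25 / 2 * (y / l) powr (1 + \<theta>)) (25 * (y / l) powr (2 / (2 - \<theta>)))"
    using le Gl unfolding y_def[symmetric] by (simp only: pos_divide_le_eq mult.commute)
  also have "\<dots> = max (25 / 2 * L * y powr (1 + \<theta>))
      (25 * ((L * R\<^sup>2 * G powr (1 - \<theta>)) powr (1 / (2 - \<theta>)) * K powr (- (1 / (2 - \<theta>)))))"
    using Gl by (simp only: max_mult_distrib_left e1 e2) simp
  also have "y powr (1 + \<theta>) = R powr (1 + \<theta>) * K powr (- ((1 + \<theta>) / 2))"
    unfolding y_def by (rule powr_divide_sqrt)
  finally show ?thesis
    using k by (auto simp: mult.assoc)
qed

lemma gap_bound:
  "\<exists>k\<le>K. \<delta> k \<le> max (Lambda1 \<theta> L R * rpow K (- ((1 + \<theta>) / 2))) (Lambda2 \<theta> L R G * rpow K (- (1 / (2 - \<theta>))))"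
proof -
  define A where "A = R powr (1 + \<theta>) * K powr (- ((1 + \<theta>) / 2))"
  define \<kappa> where "\<kappa> = K powr (- (1 / (2 - \<theta>)))"
  have nonneg: "0 \<le> A" "0 \<le> \<kappa>"
    by (simp_all add: A_def \<kappa>_def)
  have L1: "Lambda1 \<theta> L R * rpow K (- ((1 + \<theta>) / 2)) = 25 / 2 * L * A"
    using \<theta> by (simp add: Lambda1_def rpow_def A_def)
  have L2: "Lambda2 \<theta> L R G * rpow K (- (1 / (2 - \<theta>)))
      = max (25 * rpow (L * R\<^sup>2 * rpow G (1 - \<theta>)) (1 / (2 - \<theta>)) * \<kappa>) (25 * (G * R) * \<kappa>)"
    using \<theta> nonneg by (simp add: Lambda2_def rpow_def \<kappa>_def max_mult_distrib_left max_mult_distrib_right)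
  show ?thesis
  proof (cases "\<theta> = 0 \<or> G = 0")
    case True
    obtain k where k: "k \<le> K" "\<delta> k \<le> 4 / 3 * (G * R * K powr (- (1 / 2))) + 8 / 3 * (L * A)"
      using simple_bound by (auto simp: A_def mult.assoc)
    \<comment> \<open>For \<open>\<theta> = 0\<close> the exponents agree; for \<open>G = 0\<close>
      both sides vanish.\<close>
    have b: "G * R * K powr (- (1 / 2)) = G * R * \<kappa>"
      using True by (auto simp: \<kappa>_def)
    have nn: "0 \<le> L * A" "0 \<le> G * R * \<kappa>"
      using G R L nonneg by simp_all
    have "4 / 3 * b + 8 / 3 * a \<le> max (25 / 2 * a) (max q (25 * b))"
      if "0 \<le> a" "0 \<le> b" for a b q :: real
      using that by linarith
    from order_trans[OF k(2)[unfolded b] this[OF nn]] show ?thesis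
      using k(1) unfolding L1 L2 mult.assoc by blast
  next
    case False
    then have pos: "0 < \<theta>" "0 < G"
      using \<theta> G by auto
    have rpow_G: "rpow G (1 - \<theta>) = G powr (1 - \<theta>)"
      using pos by (simp add: rpow_def)
    \<comment> \<open>The least constant above \<open>L\<close> that satisfies the hypothesis of
      \<open>scaled_bound\<close>.\<close>
    define L' where "L' = max L (G / R powr \<theta>)"
    have L': "L \<le> L'" "0 < L'" "G \<le> L' * R powr \<theta>"
      using R pos by (auto simp: L'_def less_max_iff_disj pos_divide_le_eq[symmetric])
    interpret L': gap_sequence \<theta> L' G R K \<delta> t g P D
      using L'(1) by (rule raise_constant)
    obtain k where k: "k \<le> K" "\<delta> k \<le> max (25 / 2 * L' * A)
        (25 * (L' * R\<^sup>2 * G powr (1 - \<theta>)) powr (1 / (2 - \<theta>)) * \<kappa>)"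
      using L'.scaled_bound[OF pos L'(2,3)] by (auto simp: A_def \<kappa>_def mult.assoc)
    show ?thesis
    proof (cases "L' = L")
      case True
      then show ?thesis
        using k \<theta> unfolding L1 L2 rpow_G by (intro exI[of _ k]) (auto simp: rpow_def)
    next
      case False
      \<comment> \<open>With this value both terms of the bound for \<open>L'\<close> are at most
        \<open>25 * (G * R) * \<kappa>\<close>.\<close>
      then have L'_eq: "L' = G / R powr \<theta>"
        by (auto simp: L'_def max_def split: if_splits)
      have "L' * A = G * R * K powr (- ((1 + \<theta>) / 2))"
        using R by (simp add: L'_eq A_def powr_add)
      also have "\<dots> \<le> G * R * \<kappa>"
      proof -
        have "0 \<le> \<theta> * (1 - \<theta>)"
          using \<theta> by simp
        then have "1 / (2 - \<theta>) \<le> (1 + \<theta>) / 2"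
          using \<theta> by (simp add: field_simps)
        then show ?thesis
          unfolding \<kappa>_def using K G R by (intro mult_left_mono powr_mono) auto
      qed
      finally have "25 / 2 * (L' * A) \<le> 25 * (G * R * \<kappa>)"
        using mult_nonneg_nonneg[OF mult_nonneg_nonneg[OF G less_imp_le[OF R]] nonneg(2)] by linarith
      then have "25 / 2 * L' * A \<le> 25 * (G * R) * \<kappa>"
        by (simp only: mult.assoc)
      moreover have "(L' * R\<^sup>2 * G powr (1 - \<theta>)) powr (1 / (2 - \<theta>)) = G * R"
      proof -
        have "L' * R\<^sup>2 * G powr (1 - \<theta>) = (G * R) powr (2 - \<theta>)"
          using R pos powr_add[of G 1 "1 - \<theta>"]
          by (simp add: L'_eq powr_mult powr_diff[of R 2] powr_numeral)
        then show ?thesis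
          using \<theta> pos R by (simp add: powr_powr)
      qed
      ultimately show ?thesis
        using k unfolding L1 L2 by (intro exI[of _ k]) auto
    qed
  qed
qed

end

subsection \<open>Convex gradients and linear steps over a ball\<close>

lemma has_real_derivative_along_line:
  fixes f :: "'a::euclidean_space \<Rightarrow> real"
  assumes "GDERIV f x :> D"
  shows "((\<lambda>s. f (x + s *\<^sub>R v)) has_real_derivative D \<bullet> v) (at 0)"
proof -
  have "((\<lambda>s. x + s *\<^sub>R v) has_derivative (\<lambda>s. s *\<^sub>R v)) (at 0)"
    by (auto intro!: derivative_eq_intros)
  moreover have "(f has_derivative (\<lambda>h. h \<bullet> D)) (at (x + 0 *\<^sub>R v))"
    using assms by (simp add: gderiv_def)
  ultimately have "((\<lambda>s. f (x + s *\<^sub>R v)) has_derivative (\<lambda>s. (s *\<^sub>R v) \<bullet> D)) (at 0)"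
    by (rule has_derivative_compose)
  then show ?thesis
    unfolding has_field_derivative_def
    by (rule has_derivative_eq_rhs) (simp add: fun_eq_iff inner_commute)
qed

lemma gradient_inner_nonneg_of_min:
  fixes f :: "'a::euclidean_space \<Rightarrow> real"
  assumes D: "GDERIV f x :> D" and "convex X" "x \<in> X" "z \<in> X"
    and min: "\<And>u. u \<in> X \<Longrightarrow> f x \<le> f u"
  shows "0 \<le> D \<bullet> (z - x)"
proof (rule ccontr)
  assume "\<not> ?thesis"
  then obtain d where d: "0 < d" "\<And>h. 0 < h \<Longrightarrow> h < d \<Longrightarrow> f (x + h *\<^sub>R (z - x)) < f x"
    using DERIV_neg_dec_right[OF has_real_derivative_along_line[OF D, of "z - x"]] by auto
  define h where "h = min (d / 2) 1"
  have h: "0 < h" "h < d" "h \<le> 1"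
    using d(1) by (auto simp: h_def)
  have "x + h *\<^sub>R (z - x) = (1 - h) *\<^sub>R x + h *\<^sub>R z"
    by (simp add: algebra_simps)
  also have "\<dots> \<in> X"
    using assms h by (intro convexD) auto
  finally show False
    using min d(2)[of h] h by fastforce
qed

lemma convex_gradient_le:
  fixes f :: "'a::euclidean_space \<Rightarrow> real"
  assumes D: "GDERIV f x :> D" and f: "convex_on UNIV f"
  shows "f x + D \<bullet> (z - x) \<le> f z"
proof -
  have "((\<lambda>h. (f (x + h *\<^sub>R (z - x)) - f x) / h) \<longlongrightarrow> D \<bullet> (z - x)) (at_right 0)"
    using has_real_derivative_along_line[OF D, of "z - x"]
    by (auto simp: DERIV_def intro: filterlim_at_split[THEN iffD1, THEN conjunct2])
  moreover have "\<forall>\<^sub>F h in at_right 0. (f (x + h *\<^sub>R (z - x)) - f x) / h \<le> f z - f x"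
  proof (rule eventually_at_rightI[of 0 1])
    fix h :: real assume "h \<in> {0<..<1}"
    moreover have "x + h *\<^sub>R (z - x) = (1 - h) *\<^sub>R x + h *\<^sub>R z"
      by (simp add: algebra_simps)
    ultimately have "f (x + h *\<^sub>R (z - x)) \<le> (1 - h) * f x + h * f z"
      using convex_onD[OF f, of h x z] by simp
    then show "(f (x + h *\<^sub>R (z - x)) - f x) / h \<le> f z - f x"
      using \<open>h \<in> {0<..<1}\<close> by (simp add: field_simps)
  qed simp
  ultimately have "D \<bullet> (z - x) \<le> f z - f x"
    by (rule tendsto_upperbound) simp
  then show ?thesis
    by simp
qed

text \<open>
  At \<open>u = x - r e\<close>, with \<open>e\<close> the unit vector along the gradient difference, the
  tangent of \<open>f\<close> at \<open>y\<close> lies below the Hoelder upper model of \<open>f\<close> at \<open>x\<close>.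
\<close>

lemma norm_gradient_diff_le:
  fixes f :: "'a::euclidean_space \<Rightarrow> real"
  assumes Dy: "GDERIV f y :> gradient f y" and f: "convex_on UNIV f"
    and holder: "\<And>u. bregman f u x \<le> L / (1 + \<theta>) * norm (u - x) powr (1 + \<theta>)"
    and "0 \<le> L" "0 \<le> \<theta>" and r: "0 < r"
  shows "norm (gradient f x - gradient f y) \<le> bregman f x y / r + L * r powr \<theta> / (1 + \<theta>)"
proof -
  have B: "0 \<le> bregman f x y"
    using convex_gradient_le[OF Dy f, of x] by (simp add: bregman_def)
  show ?thesis
  proof (cases "gradient f x = gradient f y")
    case True
    then show ?thesis
      using B assms by simp
  next
    case False
    define e where "e = sgn (gradient f x - gradient f y)"
    have e: "norm e = 1" "(gradient f x - gradient f y) \<bullet> e = norm (gradient f x - gradient f y)"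
      using False by (simp_all add: e_def norm_sgn)
        (simp add: sgn_div_norm power2_norm_eq_inner[symmetric] power2_eq_square)
    have "f y + gradient f y \<bullet> (x - r *\<^sub>R e - y) \<le> f (x - r *\<^sub>R e)"
      by (rule convex_gradient_le[OF Dy f])
    also have "\<dots> \<le> f x - r * (gradient f x \<bullet> e) + L / (1 + \<theta>) * r powr (1 + \<theta>)"
      using holder[of "x - r *\<^sub>R e"] r e(1) by (simp add: bregman_def)
    finally have "r * ((gradient f x - gradient f y) \<bullet> e) \<le> bregman f x y + L / (1 + \<theta>) * r powr (1 + \<theta>)"
      by (simp add: bregman_def algebra_simps)
    moreover have "r powr (1 + \<theta>) = r * r powr \<theta>"
      using r by (simp add: powr_add)
    ultimately show ?thesis
      using r unfolding e(2) by (simp add: field_simps)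
  qed
qed

text \<open>
  Optimality is tested against \<open>y + s (a (x - y) + (w - y))\<close> for small \<open>s > 0\<close>;
  here \<open>a\<close> plays the role of the multiplier of the ball constraint.
\<close>

lemma ball_step_multiplier:
  fixes g x y w :: "'a::euclidean_space"
  assumes X: "convex X" "x \<in> X" "w \<in> X" "y \<in> X"
    and y: "norm (y - x) \<le> t"
    and min: "\<And>z. z \<in> X \<Longrightarrow> norm (z - x) \<le> t \<Longrightarrow> g \<bullet> y \<le> g \<bullet> z"
    and a: "0 \<le> a" "norm (y - x) < t \<or> (x - y) \<bullet> (y - w) < a * (norm (y - x))\<^sup>2"
  shows "g \<bullet> (y - w) \<le> a * (g \<bullet> (x - y))"
proof -
  define v where "v = a *\<^sub>R (x - y) + (w - y)"
  have "\<forall>\<^sub>F s in at_right 0. norm (y - x + s *\<^sub>R v) \<le> t"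
    using a(2)
  proof
    assume "norm (y - x) < t"
    moreover have "((\<lambda>s. norm (y - x + s *\<^sub>R v)) \<longlongrightarrow> norm (y - x + 0 *\<^sub>R v)) (at_right 0)"
      by (intro tendsto_intros)
    ultimately show ?thesis
      by (intro eventually_mono[OF order_tendstoD(2)]) auto
  next
    assume *: "(x - y) \<bullet> (y - w) < a * (norm (y - x))\<^sup>2"
    have "(y - x) \<bullet> v = (x - y) \<bullet> (y - w) - a * (norm (y - x))\<^sup>2"
      by (simp add: v_def power2_norm_eq_inner algebra_simps inner_commute)
    then have "2 * ((y - x) \<bullet> v) + 0 * (norm v)\<^sup>2 < 0"
      using * by simp
    moreover have "((\<lambda>s. 2 * ((y - x) \<bullet> v) + s * (norm v)\<^sup>2) \<longlongrightarrow> 2 * ((y - x) \<bullet> v) + 0 * (norm v)\<^sup>2) (at_right 0)"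
      by (intro tendsto_intros)
    ultimately have "\<forall>\<^sub>F s in at_right 0. 2 * ((y - x) \<bullet> v) + s * (norm v)\<^sup>2 < 0"
      by (intro order_tendstoD(2))
    moreover have "\<forall>\<^sub>F s :: real in at_right 0. 0 < s"
      by (rule eventually_at_right_less)
    ultimately show ?thesis
    proof eventually_elim
      case (elim s)
      have "(norm (y - x + s *\<^sub>R v))\<^sup>2 = (norm (y - x))\<^sup>2 + s * (2 * ((y - x) \<bullet> v) + s * (norm v)\<^sup>2)"
        by (simp add: power2_norm_eq_inner inner_add_left inner_add_right inner_commute algebra_simps)
      also have "\<dots> \<le> (norm (y - x))\<^sup>2"
        using elim by (simp add: mult_le_0_iff)
      finally show ?case
        using y by (meson norm_ge_zero order_trans power2_le_imp_le)
    qed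
  qed
  moreover have "\<forall>\<^sub>F s in at_right 0. s < 1 / (a + 1) \<and> 0 < s"
    using a(1) by (intro eventually_at_rightI[of 0 "1 / (a + 1)"]) auto
  ultimately have "\<forall>\<^sub>F s :: real in at_right 0. 0 \<le> g \<bullet> v"
  proof eventually_elim
    case (elim s)
    have "s * (a + 1) < 1"
      using elim a(1) by (simp add: field_simps)
    \<comment> \<open>The test point is a convex combination of \<open>y\<close>, with weight
      \<open>1 - s * (a + 1)\<close>, and a point of the segment from \<open>w\<close> to
      \<open>x\<close>.\<close>
    moreover define c where "c = a / (a + 1)"
    have c: "0 \<le> c" "c \<le> 1" "s * (a + 1) * c = s * a" "s * (a + 1) * (1 - c) = s"
      using a(1) by (auto simp: c_def field_simps)
    moreover have "(1 - c) *\<^sub>R w + c *\<^sub>R x \<in> X"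
      using X c by (intro convexD_alt)
    ultimately have "(1 - s * (a + 1)) *\<^sub>R y + (s * (a + 1)) *\<^sub>R ((1 - c) *\<^sub>R w + c *\<^sub>R x) \<in> X"
      using elim X a(1) by (intro convexD_alt) auto
    also have "(s * (a + 1)) *\<^sub>R ((1 - c) *\<^sub>R w + c *\<^sub>R x) = s *\<^sub>R w + (s * a) *\<^sub>R x"
      by (simp only: scaleR_add_right scaleR_scaleR c)
    also have "(1 - s * (a + 1)) *\<^sub>R y + (s *\<^sub>R w + (s * a) *\<^sub>R x) = y + s *\<^sub>R v"
      by (simp add: v_def algebra_simps)
    finally have "g \<bullet> y \<le> g \<bullet> (y + s *\<^sub>R v)"
      using elim by (intro min) (auto simp: algebra_simps)
    then show ?case
      using elim by (simp add: inner_add_right zero_le_mult_iff)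
  qed
  then have "0 \<le> g \<bullet> v"
    by simp
  then show ?thesis
    by (simp add: v_def algebra_simps)
qed

text \<open>The condition on \<open>t\<close> keeps the ball from crossing the hyperplane through
  \<open>w\<close> orthogonal to \<open>g\<close>. The last claim is the multiplier inequality as
  \<open>a\<close> decreases to \<open>((x - y) \<bullet> (y - w)) / t\<^sup>2\<close>.\<close>

lemma ball_step:
  fixes g x y w :: "'a::euclidean_space"
  assumes X: "convex X" "x \<in> X" "w \<in> X" "y \<in> X"
    and y: "norm (y - x) \<le> t"
    and min: "\<And>z. z \<in> X \<Longrightarrow> norm (z - x) \<le> t \<Longrightarrow> g \<bullet> y \<le> g \<bullet> z"
    and g: "g \<noteq> 0" and t: "0 < t" "t * norm g \<le> g \<bullet> (x - w)"
  shows "norm (y - x) = t" (is ?N)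
    and "0 \<le> (x - y) \<bullet> (y - w)" (is ?B)
    and "t\<^sup>2 * (g \<bullet> (y - w)) \<le> (g \<bullet> (x - y)) * ((x - y) \<bullet> (y - w))" (is ?Q)
proof -
  note multiplier = ball_step_multiplier[OF X y min]
  have split: "g \<bullet> (x - w) = g \<bullet> (x - y) + g \<bullet> (y - w)"
    by (simp add: algebra_simps)
  have "?N \<and> ?B \<and> ?Q"
  proof (cases "g \<bullet> (y - w) \<le> 0")
    case True
    text \<open>Equality holds in the Cauchy-Schwarz inequality, so \<open>x - y\<close> is a multiple of \<open>g\<close>.\<close>
    have "g \<bullet> (x - y) \<le> norm g * norm (x - y)"
      by (rule norm_cauchy_schwarz)
    moreover have "norm g * norm (x - y) \<le> t * norm g"
      using mult_left_mono[OF y norm_ge_zero[of g]] by (simp add: norm_minus_commute mult.commute)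
    ultimately have eq: "g \<bullet> (x - y) = norm g * norm (x - y)" "norm g * norm (x - y) = t * norm g"
        "g \<bullet> (y - w) = 0"
      using True t(2) split by linarith+
    then have "norm g *\<^sub>R (x - y) = norm (x - y) *\<^sub>R g"
      by (simp only: norm_cauchy_schwarz_eq[symmetric])
    then have "norm g * ((x - y) \<bullet> (y - w)) = norm (x - y) * (g \<bullet> (y - w))"
      by (metis inner_scaleR_left)
    then have "(x - y) \<bullet> (y - w) = 0"
      using eq g by simp
    then show ?thesis
      using eq g by (simp add: norm_minus_commute)
  next
    case False
    \<comment> \<open>With \<open>a = 0\<close> the multiplier inequality would contradict
      \<open>g \<bullet> (y - w) > 0\<close>, so both of its alternatives fail.\<close>
    have N: ?N
      using multiplier[of 0] False y by fastforce
    have B: ?B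
      using multiplier[of 0] False by fastforce
    have ?Q
    proof (rule ccontr)
      assume "\<not> ?Q"
      moreover define P Q b where "P = g \<bullet> (x - y)" and "Q = g \<bullet> (y - w)" and "b = (x - y) \<bullet> (y - w)"
      ultimately have Q: "P * (b / t\<^sup>2) < Q" "0 < Q"
        using t(1) False by (simp_all add: field_simps)
      have "0 \<le> P"
        using min[of x] X t(1) by (simp add: P_def inner_diff_right)
      have "\<exists>a>b / t\<^sup>2. P * a < Q"
      proof (cases "P = 0")
        case True
        then show ?thesis
          using Q(2) gt_ex by auto
      next
        case False
        then have "b / t\<^sup>2 < Q / P"
          using Q(1) \<open>0 \<le> P\<close> by (simp add: field_simps)
        from dense[OF this] show ?thesis
          using False \<open>0 \<le> P\<close> by (auto simp: field_simps)
      qed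
      then obtain a where a: "b / t\<^sup>2 < a" "P * a < Q"
        by blast
      moreover have "0 \<le> b / t\<^sup>2"
        using B by (simp add: b_def)
      ultimately have "0 \<le> a"
        by linarith
      moreover have "b < a * t\<^sup>2"
        using a(1) t(1) by (simp add: field_simps)
      ultimately have "Q \<le> a * P"
        using multiplier[of a] N by (simp add: P_def Q_def b_def)
      then show False
        using a(2) by (simp add: mult.commute)
    qed
    then show ?thesis
      using N B by simp
  qed
  then show ?N ?B ?Q
    by auto
qed

subsection \<open>The convergence rate\<close>

lemma mem_argmin_set_iff:
  fixes f :: "'a \<Rightarrow> real"
  shows "x \<in> argmin_set f S \<longleftrightarrow> x \<in> S \<and> (\<forall>z\<in>S. f x \<le> f z)"
  by (auto simp: argmin_set_def is_arg_min_linorder)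

lemma min_value_eq:
  assumes "x \<in> argmin_set f S"
  shows "min_value f S = f x"
  unfolding min_value_def
  using assms by (intro cInf_eq_minimum) (auto simp: mem_argmin_set_iff)

text \<open>The solution set is closed, being the intersection of \<open>X\<close> with a sublevel
  set of \<open>f\<close>.\<close>

lemma argmin_set_attains_infdist:
  fixes f :: "'a::euclidean_space \<Rightarrow> real"
  assumes "closed X" "continuous_on UNIV f" "argmin_set f X \<noteq> {}"
  obtains w where "w \<in> argmin_set f X" "infdist x (argmin_set f X) = dist x w"
proof -
  obtain p where p: "p \<in> argmin_set f X"
    using assms(3) by blast
  have "argmin_set f X = X \<inter> {z. f z \<le> f p}"
    using p by (fastforce simp: mem_argmin_set_iff)
  moreover have "closed {z. f z \<le> f p}"
    using assms(2) by (intro closed_Collect_le) auto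
  ultimately have "closed (argmin_set f X)"
    using assms(1) by auto
  from infdist_attains_inf[OF this assms(3), of x] that show thesis
    by blast
qed

theorem theorem4:
  fixes f :: "'a::euclidean_space \<Rightarrow> real" and X :: "'a set"
    and \<theta> L :: real and x :: "nat \<Rightarrow> 'a" and xstar :: 'a and K :: nat
  assumes "X \<noteq> {}" and "closed X" and "convex X"
    and "convex_on UNIV f" and "f differentiable_on UNIV"
    and "argmin_set f X \<noteq> {}"
    and "0 \<le> \<theta>" and "\<theta> \<le> 1" and "0 \<le> L"
    and "\<And>u v. bregman f u v \<le> L / (1 + \<theta>) * rpow (norm (u - v)) (1 + \<theta>)"
    and "is_run f X x"
    and "xstar \<in> argmin_set f X"
    and "K \<ge> 1"
  shows "Min ((\<lambda>k. f (x k) - min_value f X) ` ({0..K} \<inter> generated f X x))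
    \<le> max (Lambda1 \<theta> L (infdist (x 0) (argmin_set f X)) * rpow (real K) (- ((1 + \<theta>) / 2)))
           (Lambda2 \<theta> L (infdist (x 0) (argmin_set f X)) (norm (gradient f xstar))
              * rpow (real K) (- (1 / (2 - \<theta>))))"
proof -
  define \<delta> where "\<delta> k = f (x k) - min_value f X" for k
  define R where "R = infdist (x 0) (argmin_set f X)"
  define G where "G = norm (gradient f xstar)"
  define B where "B = max (Lambda1 \<theta> L R * rpow (real K) (- ((1 + \<theta>) / 2)))
      (Lambda2 \<theta> L R G * rpow (real K) (- (1 / (2 - \<theta>))))"
  have Min_le: "Min (\<delta> ` ({0..K} \<inter> generated f X x)) \<le> \<delta> k" if "k \<le> K" "k \<in> generated f X x" for k
    using that by (intro Min_le) auto
  have "\<exists>k\<le>K. k \<in> generated f X x \<and> \<delta> k \<le> B"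
  proof (cases "\<exists>k\<le>K. x k \<in> argmin_set f X")
    case True
    then obtain j where j: "j \<le> K" "x j \<in> argmin_set f X"
      by blast
    obtain k where k: "x k \<in> argmin_set f X" and least: "\<And>i. x i \<in> argmin_set f X \<Longrightarrow> k \<le> i"
      using LeastI[of "\<lambda>k. x k \<in> argmin_set f X", OF j(2)] Least_le[of "\<lambda>k. x k \<in> argmin_set f X"]
      by blast
    have "k \<le> K"
      using least[OF j(2)] j(1) by simp
    moreover have "k \<in> generated f X x"
      using least by (force simp: generated_def)
    moreover have "\<delta> k = 0"
      using min_value_eq[OF k] by (simp add: \<delta>_def)
    moreover have "0 \<le> B"
    proof -
      have "0 \<le> G * R"
        by (simp add: G_def R_def infdist_nonneg)
      then have "0 \<le> Lambda2 \<theta> L R G"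
        by (simp add: Lambda2_def)
      moreover have "0 \<le> rpow (real K) (- (1 / (2 - \<theta>)))"
        by (simp add: rpow_def)
      ultimately show ?thesis
        unfolding B_def by (intro order_trans[OF mult_nonneg_nonneg max.cobounded2])
    qed
    ultimately show ?thesis
      by force
  next
    case False
    \<comment> \<open>No solution occurs up to index \<open>K\<close>, so the iterate with index
      \<open>Suc K\<close> is generated as well.\<close>
    then have gen: "k \<in> generated f X x" if "k \<le> Suc K" for k
      using that by (auto simp: generated_def)
    have D: "GDERIV f u :> gradient f u" for u
      using assms(5) by (intro differentiable_imp_GDERIV_gradient) (auto simp: differentiable_on_def)
    have "continuous_on UNIV f"
      using assms(5) by (rule differentiable_imp_continuous_on)
    \<comment> \<open>Distances are measured to the solution nearest to \<open>x 0\<close>, so that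
      their telescoping sum is at most \<open>R\<^sup>2\<close>.\<close>
    then obtain w where w: "w \<in> argmin_set f X" "R = dist (x 0) w"
      using argmin_set_attains_infdist[OF assms(2) _ assms(6), of "x 0"] unfolding R_def by blast
    have fw: "f w = min_value f X" "w \<in> X" and fs: "f xstar = min_value f X" "xstar \<in> X"
      using w(1) assms(12) min_value_eq[OF w(1)] min_value_eq[OF assms(12)] by (auto simp: mem_argmin_set_iff)
    have step: "x (Suc k) \<in> argmin_set (\<lambda>z. gradient f (x k) \<bullet> z) (X \<inter> cball (x k) (step_radius f X (x k)))"
      if "k \<le> K" for k
      using assms(11) gen[of "Suc k"] that by (auto simp: is_run_def)
    have xX: "x k \<in> X" if "k \<le> Suc K" for k
      using assms(11) step[of "k - 1"] that
      by (cases k) (auto simp: is_run_def mem_argmin_set_iff)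
    define g where "g k = norm (gradient f (x k))" for k
    define t where "t k = step_radius f X (x k)" for k
    have t_eq: "t k = \<delta> k / g k" for k
      by (simp add: t_def step_radius_def g_def \<delta>_def)
    have \<delta>_pos: "0 < \<delta> k" if "k \<le> K" for k
    proof -
      have "x k \<notin> argmin_set f X" "x k \<in> X"
        using False xX that by auto
      then obtain z where "z \<in> X" "f z < f (x k)"
        by (auto simp: mem_argmin_set_iff not_le)
      then show ?thesis
        using w(1) fw by (auto simp: \<delta>_def mem_argmin_set_iff)
    qed
    have \<delta>_le: "\<delta> k \<le> gradient f (x k) \<bullet> (x k - w)" for k
      using convex_gradient_le[OF D assms(4), of "x k" w] fw by (simp add: \<delta>_def inner_diff_right)
    have grad_nz: "gradient f (x k) \<noteq> 0" if "k \<le> K" for k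
      using \<delta>_le[of k] \<delta>_pos[OF that] by auto
    then have g_pos: "0 < g k" if "k \<le> K" for k
      using that by (simp add: g_def)
    have holder: "bregman f u v \<le> L / (1 + \<theta>) * norm (u - v) powr (1 + \<theta>)" for u v
      using assms(7) assms(10)[of u v] by (simp add: rpow_def)
    define P where "P k = gradient f (x k) \<bullet> (x k - x (Suc k))" for k
    define S where "S k = (norm (x k - w))\<^sup>2 - (norm (x (Suc k) - w))\<^sup>2" for k
    define b where "b k = (x k - x (Suc k)) \<bullet> (x (Suc k) - w)" for k
    have geometry: "norm (x (Suc k) - x k) = t k" "0 \<le> b k"
      "(t k)\<^sup>2 * (gradient f (x k) \<bullet> (x (Suc k) - w)) \<le> P k * b k" if "k \<le> K" for k
    proof -
      have mem: "x (Suc k) \<in> X" "norm (x (Suc k) - x k) \<le> t k"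
        and min: "\<And>z. z \<in> X \<Longrightarrow> norm (z - x k) \<le> t k \<Longrightarrow> gradient f (x k) \<bullet> x (Suc k) \<le> gradient f (x k) \<bullet> z"
        using step[OF that] by (auto simp: mem_argmin_set_iff t_def dist_norm norm_minus_commute)
      \<comment> \<open>The radius is admissible for \<open>ball_step\<close>:
        \<open>t k * g k\<close> is the gap, which convexity bounds by the linear model.\<close>
      have "0 < t k" "t k * norm (gradient f (x k)) \<le> gradient f (x k) \<bullet> (x k - w)"
        using \<delta>_pos[OF that] g_pos[OF that] \<delta>_le[of k] by (simp_all add: t_eq g_def[symmetric])
      note * = ball_step[OF assms(3) xX fw(2) mem min grad_nz[OF that] this, OF le_SucI[OF that]]
      show "norm (x (Suc k) - x k) = t k" "0 \<le> b k"
        "(t k)\<^sup>2 * (gradient f (x k) \<bullet> (x (Suc k) - w)) \<le> P k * b k"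
        using * that by (simp_all add: b_def P_def)
    qed
    \<comment> \<open>Three-point identity for squared distances.\<close>
    have S_eq: "S k - (t k)\<^sup>2 = 2 * b k" if "k \<le> K" for k
      unfolding geometry(1)[OF that, symmetric] S_def b_def power2_norm_eq_inner
      by (simp add: algebra_simps inner_commute)
    have "gap_sequence \<theta> L G R K \<delta> t g P S"
    proof
      show "0 < R"
        using False w by (auto simp: mem_argmin_set_iff)
      show "(\<Sum>k<K. S k) \<le> R\<^sup>2"
        using sum_lessThan_telescope'[of "\<lambda>k. (norm (x k - w))\<^sup>2" K] w(2)
        by (simp add: S_def dist_norm)
      show "0 \<le> G"
        by (simp add: G_def)
      show "0 < \<delta> k" if "k \<le> K" for k
        using \<delta>_pos that .
      fix k assume "k < K"
      then have k: "k \<le> K" by simp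
      show t: "0 < t k"
        using \<delta>_pos[OF k] g_pos[OF k] by (simp add: t_eq)
      show "\<delta> k = t k * g k"
        using g_pos[OF k] by (simp add: t_eq)
      show "\<bar>g k - G\<bar> \<le> \<delta> k / r + L * r powr \<theta> / (1 + \<theta>)" if r: "0 < r" for r
      proof -
        \<comment> \<open>First-order optimality of \<open>xstar\<close> bounds the Bregman
          divergence by the gap.\<close>
        have "0 \<le> gradient f xstar \<bullet> (x k - xstar)"
          using gradient_inner_nonneg_of_min[OF D assms(3) fs(2) xX] k assms(12)
          by (auto simp: mem_argmin_set_iff)
        then have "bregman f (x k) xstar / r \<le> \<delta> k / r"
          using r by (intro divide_right_mono) (auto simp: bregman_def \<delta>_def fs)
        moreover have "\<bar>g k - G\<bar> \<le> norm (gradient f (x k) - gradient f xstar)"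
          unfolding g_def G_def by (rule norm_triangle_ineq3)
        ultimately show ?thesis
          using norm_gradient_diff_le[OF D assms(4) holder assms(9,7) r] by (smt (verit))
      qed
      define A where "A = L * t k powr (1 + \<theta>) / (1 + \<theta>)"
      have upper: "f (x (Suc k)) \<le> f (x k) - P k + A"
        using holder[of "x (Suc k)" "x k"] geometry(1)[OF k]
        by (simp add: bregman_def P_def A_def inner_diff_right)
      then show "\<delta> (Suc k) \<le> \<delta> k - P k + L * t k powr (1 + \<theta>) / (1 + \<theta>)"
        by (simp add: \<delta>_def A_def)
      \<comment> \<open>The upper model gives
        \<open>\<delta> (Suc k) - A \<le> \<delta> k - P k\<close>, and convexity bounds
        \<open>\<delta> k\<close>.\<close>
      have "\<delta> (Suc k) - A \<le> gradient f (x k) \<bullet> (x (Suc k) - w)"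
        using upper \<delta>_le[of k] by (simp add: \<delta>_def P_def inner_diff_right)
      then have "(t k)\<^sup>2 * (\<delta> (Suc k) - A) \<le> P k * b k"
        using geometry(3)[OF k] by (meson mult_left_mono order_trans zero_le_power2)
      then show "2 * (t k)\<^sup>2 * (\<delta> (Suc k) - L * t k powr (1 + \<theta>) / (1 + \<theta>)) \<le> P k * (S k - (t k)\<^sup>2)"
        unfolding S_eq[OF k] by (simp add: A_def)
      show "(t k)\<^sup>2 \<le> S k"
        using S_eq[OF k] geometry(2)[OF k] by simp
    qed (use assms in auto)
    from gap_sequence.gap_bound[OF this] show ?thesis
      using gen by (auto simp: B_def)
  qed
  then show ?thesis
    using Min_le unfolding \<delta>_def B_def R_def G_def by (meson order_trans)
qed

end
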